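(* Let $1\leq p\leq q\leq\infty$, let $E$ be a locally convex space, and let $T$ be an operator from $E$ to a normed space $L$. Then $T$ is $(q,p)$-convergent if and only if $T^\ast(B_{L'})$ is a $(p,q)$-$(EV)$ subset of $E'$.
   Context: All locally convex spaces are Hausdorff, over $\mathbb{F}\in\{\mathbb{R},\mathbb{C}\}$. An operator is a continuous linear map; $T^\ast:L'\to E'$ is its adjoint, and $B_{L'}$ is the closed unit ball of the Banach dual of $L$. A sequence $\{x_n\}_{n\in\omega}$ in $E$ is weakly $p$-summable if $(\langle\chi,x_n\rangle)_n\in\ell_p$ (or $\in c_0$ if $p=\infty$) for every $\chi\in E'$. A sequence $\{y_n\}$ in a normed space is strongly $q$-summable if $(\|y_n\|)_n\in\ell_q$ (or $\in c_0$ if $q=\infty$). A linear map $T:E\to L$ is $(q,p)$-convergent if it sends weakly $p$-summable sequences in $E$ to strongly $q$-summable sequences in $L$. A non-empty subset $B\subseteq E'$ is a $(p,q)$-$(EV)$ set if it is equicontinuous (i.e. contained in the polar of a neighborhood of zero in $E$) and $\big(\sup_{\chi\in B}|\langle\chi,x_n\rangle|\big)_n\in\ell_q$ (or $\in c_0$ if $q=\infty$) for every weakly $p$-summable sequence $\{x_n\}$ in $E$. *)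

theory Defs
  imports "HOL-Analysis.Analysis"
begin

(* The scalar field F is a type variable ranging over isometric copies of the reals and of the
   complex numbers. *)
class real_or_complex = real_normed_field +
  assumes iso_real_or_complex:
    "(\<exists>h :: 'a \<Rightarrow> real. bij h \<and>
        (\<forall>x y. h (x + y) = h x + h y) \<and> (\<forall>r x. h (r *\<^sub>R x) = r *\<^sub>R h x) \<and>
        (\<forall>x y. h (x * y) = h x * h y) \<and> (\<forall>x. norm (h x) = norm x)) \<or>
     (\<exists>h :: 'a \<Rightarrow> complex. bij h \<and>
        (\<forall>x y. h (x + y) = h x + h y) \<and> (\<forall>r x. h (r *\<^sub>R x) = r *\<^sub>R h x) \<and>
        (\<forall>x y. h (x * y) = h x * h y) \<and> (\<forall>x. norm (h x) = norm x))"

instance real :: real_or_complex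
  by standard (rule disjI1, rule exI[of _ "\<lambda>x. x"], simp add: bij_id[unfolded id_def])

instance complex :: real_or_complex
  by standard (rule disjI2, rule exI[of _ "\<lambda>x. x"], simp add: bij_id[unfolded id_def])

(* A vector space over F is a type with its library real vector space structure and a compatible
   multiplication by scalars from F.  This makes the library notions of convexity (which only
   involves real scalars) and of norm available for both choices of F. *)
locale scalar_vector_space = vector_space scale
  for scale :: "'k::real_or_complex \<Rightarrow> 'e::real_vector \<Rightarrow> 'e" +
  assumes scale_of_real: "scale (of_real r) x = r *\<^sub>R x"

locale locally_convex_space = scalar_vector_space scale
  for scale :: "'k::real_or_complex \<Rightarrow> 'e::{real_vector,topological_ab_group_add,t2_space} \<Rightarrow> 'e" +
  assumes continuous_scale: "continuous_on UNIV (\<lambda>(c, x). scale c x)"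
    and convex_neighborhood:
      "open (U :: 'e set) \<Longrightarrow> 0 \<in> U \<Longrightarrow> \<exists>V. open V \<and> 0 \<in> V \<and> convex V \<and> V \<subseteq> U"

locale scalar_normed_space = scalar_vector_space scale
  for scale :: "'k::real_or_complex \<Rightarrow> 'l::real_normed_vector \<Rightarrow> 'l" +
  assumes norm_scale: "norm (scale c x) = norm c * norm x"

definition continuous_operator ::
  "('k::real_or_complex \<Rightarrow> 'e::{real_vector,topological_space} \<Rightarrow> 'e) \<Rightarrow>
   ('k \<Rightarrow> 'l::{real_vector,topological_space} \<Rightarrow> 'l) \<Rightarrow> ('e \<Rightarrow> 'l) \<Rightarrow> bool" where
  "continuous_operator sE sL T \<longleftrightarrow> Vector_Spaces.linear sE sL T \<and> continuous_on UNIV T"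

definition topological_dual ::
  "('k::real_or_complex \<Rightarrow> 'e::{real_vector,topological_space} \<Rightarrow> 'e) \<Rightarrow> ('e \<Rightarrow> 'k) set" where
  "topological_dual sE = {\<phi>. continuous_operator sE (*) \<phi>}"

definition dual_unit_ball ::
  "('k::real_or_complex \<Rightarrow> 'l::real_normed_vector \<Rightarrow> 'l) \<Rightarrow> ('l \<Rightarrow> 'k) set" where
  "dual_unit_ball sL = {\<phi> \<in> topological_dual sL. onorm \<phi> \<le> 1}"

definition dual_map :: "('e \<Rightarrow> 'l) \<Rightarrow> ('l \<Rightarrow> 'k) \<Rightarrow> ('e \<Rightarrow> 'k)" where
  "dual_map T \<phi> = (\<lambda>x. \<phi> (T x))"

(* Membership in l_p for p < \<infinity>, and in c_0 (not l_\<infinity>) for p = \<infinity>. *)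
definition lp_or_c0 :: "ereal \<Rightarrow> (nat \<Rightarrow> 'a::real_normed_vector) \<Rightarrow> bool" where
  "lp_or_c0 p a \<longleftrightarrow>
     (if p = \<infinity> then a \<longlonglongrightarrow> 0 else summable (\<lambda>n. norm (a n) powr real_of_ereal p))"

definition weakly_summable ::
  "('k::real_or_complex \<Rightarrow> 'e::{real_vector,topological_space} \<Rightarrow> 'e) \<Rightarrow> ereal \<Rightarrow> (nat \<Rightarrow> 'e) \<Rightarrow> bool" where
  "weakly_summable sE p x \<longleftrightarrow> (\<forall>\<phi> \<in> topological_dual sE. lp_or_c0 p (\<lambda>n. \<phi> (x n)))"

definition strongly_summable :: "ereal \<Rightarrow> (nat \<Rightarrow> 'l::real_normed_vector) \<Rightarrow> bool" where
  "strongly_summable q y \<longleftrightarrow> lp_or_c0 q (\<lambda>n. norm (y n))"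

definition convergent_map ::
  "('k::real_or_complex \<Rightarrow> 'e::{real_vector,topological_space} \<Rightarrow> 'e) \<Rightarrow>
   ('k \<Rightarrow> 'l::real_normed_vector \<Rightarrow> 'l) \<Rightarrow> ereal \<Rightarrow> ereal \<Rightarrow> ('e \<Rightarrow> 'l) \<Rightarrow> bool" where
  "convergent_map sE sL q p T \<longleftrightarrow>
     Vector_Spaces.linear sE sL T \<and>
     (\<forall>x. weakly_summable sE p x \<longrightarrow> strongly_summable q (\<lambda>n. T (x n)))"

definition polar ::
  "('k::real_or_complex \<Rightarrow> 'e::{real_vector,topological_space} \<Rightarrow> 'e) \<Rightarrow> 'e set \<Rightarrow> ('e \<Rightarrow> 'k) set" where
  "polar sE U = {\<phi> \<in> topological_dual sE. \<forall>x \<in> U. norm (\<phi> x) \<le> 1}"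

definition equicontinuous_set ::
  "('k::real_or_complex \<Rightarrow> 'e::{real_vector,topological_space} \<Rightarrow> 'e) \<Rightarrow> ('e \<Rightarrow> 'k) set \<Rightarrow> bool" where
  "equicontinuous_set sE B \<longleftrightarrow> (\<exists>U. 0 \<in> interior U \<and> B \<subseteq> polar sE U)"

(* The real-valued supremum is never a junk value: a non-empty equicontinuous set is pointwise
   bounded. *)
definition EV_set ::
  "('k::real_or_complex \<Rightarrow> 'e::{real_vector,topological_space} \<Rightarrow> 'e) \<Rightarrow> ereal \<Rightarrow> ereal \<Rightarrow>
   ('e \<Rightarrow> 'k) set \<Rightarrow> bool" where
  "EV_set sE p q B \<longleftrightarrow>
     B \<noteq> {} \<and> B \<subseteq> topological_dual sE \<and> equicontinuous_set sE B \<and>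
     (\<forall>x. weakly_summable sE p x \<longrightarrow> lp_or_c0 q (\<lambda>n. SUP \<phi>\<in>B. norm (\<phi> (x n))))"

end

theory Submission
  imports Defs
begin

text \<open>
  The adjoint turns the supremum in the definition of a \<open>(p,q)\<close>-(EV) set into a norm: for every
  \<open>x \<in> E\<close>,
  \[ \sup_{\chi \in T^*(B_{L'})} |\langle \chi, x\rangle|
       = \sup_{\phi \in B_{L'}} |\langle \phi, T x\rangle| = \|T x\|, \]
  so the summability conditions on the two sides concern one and the same scalar sequence
  \<open>\<parallel>T x\<^sub>n\<parallel>\<close>. The remaining clauses of \<open>EV_set\<close> hold for every operator \<open>T\<close>: the adjoint maps
  into \<open>E'\<close>, and \<open>T\<^sup>*(B\<^bsub>L'\<^esub>)\<close> lies in the polar of the neighbourhood \<open>{x. \<parallel>T x\<parallel> < 1}\<close> of zero.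

  The second equality above (\<open>SUP_dual_unit_ball\<close>) is the substance. It needs a functional of norm
  at most one attaining \<open>\<parallel>y\<parallel>\<close> at a given \<open>y \<in> L\<close>, which is the Hahn--Banach theorem. The real
  form (\<open>supporting_linear_functional\<close>) rests on the observation that a minimal sublinear
  functional is linear; minimal ones exist by Zorn's lemma. A real functional \<open>f\<close> is passed to the
  scalar field by the usual formula \<open>\<phi> x = f x - i f (i x)\<close>. The same formula serves both scalar
  fields when \<open>i = 0\<close> is taken in the real case (\<open>imaginary_unit_or_zero\<close>).
\<close>

section \<open>Minimal sublinear functionals\<close>

definition sublinear :: "('v::real_vector \<Rightarrow> real) \<Rightarrow> bool" where
  "sublinear f \<longleftrightarrow> (\<forall>x y. f (x + y) \<le> f x + f y) \<and> (\<forall>r\<ge>0. \<forall>x. f (r *\<^sub>R x) = r * f x)"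

lemma sublinear_add: "sublinear f \<Longrightarrow> f (x + y) \<le> f x + f y"
  by (simp add: sublinear_def)

lemma sublinear_scaleR: "sublinear f \<Longrightarrow> 0 \<le> r \<Longrightarrow> f (r *\<^sub>R x) = r * f x"
  by (simp add: sublinear_def)

lemma sublinear_zero: "sublinear f \<Longrightarrow> f 0 = 0"
  using sublinear_scaleR[of f 0 0] by simp

lemma sublinear_norm: "sublinear (norm :: 'v::real_normed_vector \<Rightarrow> real)"
  by (simp add: sublinear_def norm_triangle_ineq)

text \<open>An inequality suffices for homogeneity, because it can be applied to \<open>1 / r\<close> as well.\<close>

lemma sublinearI:
  assumes add: "\<And>x y. f (x + y) \<le> f x + f y"
    and scale: "\<And>r x. 0 \<le> r \<Longrightarrow> f (r *\<^sub>R x) \<le> r * f x"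
  shows "sublinear f"
proof -
  have f0: "f 0 = 0"
    using add[of 0 0] scale[of 0 0] by simp
  have "f (r *\<^sub>R x) = r * f x" if "0 \<le> r" for r x
  proof (cases "r = 0")
    case False
    with that have r: "0 < r"
      by simp
    have "f x \<le> inverse r * f (r *\<^sub>R x)"
      using scale[of "inverse r" "r *\<^sub>R x"] r by simp
    then have "r * f x \<le> f (r *\<^sub>R x)"
      using r by (simp add: field_simps)
    with scale[OF that] show ?thesis
      by (simp add: order.antisym)
  qed (simp add: f0)
  with add show ?thesis
    by (simp add: sublinear_def)
qed

text \<open>
  This covers both infima needed below: that of a chain of sublinear functionals, and that of a
  family indexed by a ray, whose members are not themselves sublinear.
\<close>

lemma sublinear_INF:
  fixes g :: "'i \<Rightarrow> 'v::real_vector \<Rightarrow> real"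
  assumes ne: "I \<noteq> {}"
    and bdd: "\<And>x. bdd_below ((\<lambda>i. g i x) ` I)"
    and add: "\<And>i j x y. i \<in> I \<Longrightarrow> j \<in> I \<Longrightarrow> \<exists>k\<in>I. g k (x + y) \<le> g i x + g j y"
    and scale: "\<And>i r x. i \<in> I \<Longrightarrow> 0 \<le> r \<Longrightarrow> \<exists>k\<in>I. g k (r *\<^sub>R x) \<le> r * g i x"
  shows "sublinear (\<lambda>x. INF i\<in>I. g i x)"
proof (rule sublinearI)
  let ?f = "\<lambda>x. INF i\<in>I. g i x"
  have lower: "?f x \<le> g i x" if "i \<in> I" for i x
    using that by (intro cINF_lower bdd)
  fix x y :: 'v
  have "?f (x + y) \<le> g i x + g j y" if "i \<in> I" "j \<in> I" for i j
    using add[OF that, of x y] lower order.trans by blast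
  then have "?f (x + y) - g j y \<le> ?f x" if "j \<in> I" for j
    using that by (intro cINF_greatest ne) (simp add: algebra_simps)
  then have "?f (x + y) - ?f x \<le> ?f y"
    by (intro cINF_greatest ne) (simp add: algebra_simps)
  then show "?f (x + y) \<le> ?f x + ?f y"
    by simp
next
  let ?f = "\<lambda>x. INF i\<in>I. g i x"
  fix r :: real and x :: 'v
  assume r: "0 \<le> r"
  have le: "?f (r *\<^sub>R x) \<le> r * g i x" if "i \<in> I" for i
    using scale[OF that r, of x] cINF_lower[OF bdd] order.trans by blast
  show "?f (r *\<^sub>R x) \<le> r * ?f x"
  proof (cases "r = 0")
    case True
    with le ne show ?thesis
      by auto
  next
    case False
    with r have "0 < r"
      by simp
    then have "?f (r *\<^sub>R x) / r \<le> ?f x"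
      using le by (intro cINF_greatest ne) (simp add: field_simps)
    with \<open>0 < r\<close> show ?thesis
      by (simp add: field_simps)
  qed
qed

text \<open>
  The functional \<open>x \<mapsto> inf\<^bsub>t\<ge>0\<^esub> (f (x + t z) - t f z)\<close> is the largest sublinear \<open>g \<le> f\<close> with
  \<open>g (- z) \<le> - f z\<close>; the terms \<open>t = 0\<close> and \<open>t = 1\<close> give the two bounds.
\<close>

lemma sublinear_lowered_along_ray:
  fixes f :: "'v::real_vector \<Rightarrow> real"
  assumes f: "sublinear f"
  obtains g where "sublinear g" "\<And>x. g x \<le> f x" "\<And>x. g x \<le> f (x + z) - f z"
proof
  let ?h = "\<lambda>t x. f (x + t *\<^sub>R z) - t * f z"
  let ?g = "\<lambda>x. INF t\<in>{0..}. ?h t x"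
  have "- f (- x) \<le> ?h t x" if "0 \<le> t" for t x
    using sublinear_add[OF f, of "x + t *\<^sub>R z" "- x"] sublinear_scaleR[OF f that, of z] by simp
  then have bdd: "bdd_below ((\<lambda>t. ?h t x) ` {0..})" for x
    by (intro bdd_belowI2[where m = "- f (- x)"]) auto
  show "?g x \<le> f x" for x
    using cINF_lower[OF bdd, of 0 x] by simp
  show "?g x \<le> f (x + z) - f z" for x
    using cINF_lower[OF bdd, of 1 x] by simp
  show "sublinear ?g"
  proof (rule sublinear_INF)
    fix s t :: real and x y :: 'v
    assume "s \<in> {0..}" "t \<in> {0..}"
    moreover have "?h (s + t) (x + y) \<le> ?h s x + ?h t y"
      using sublinear_add[OF f, of "x + s *\<^sub>R z" "y + t *\<^sub>R z"] by (simp add: algebra_simps)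
    ultimately show "\<exists>k\<in>{0..}. ?h k (x + y) \<le> ?h s x + ?h t y"
      by (intro bexI[of _ "s + t"]) auto
  next
    fix t r :: real and x :: 'v
    assume "t \<in> {0..}" and r: "0 \<le> r"
    moreover have "?h (r * t) (r *\<^sub>R x) = r * ?h t x"
      using sublinear_scaleR[OF f r, of "x + t *\<^sub>R z"] by (simp add: algebra_simps)
    ultimately show "\<exists>k\<in>{0..}. ?h k (r *\<^sub>R x) \<le> r * ?h t x"
      by (intro bexI[of _ "r * t"]) auto
  qed (use bdd in auto)
qed

text \<open>
  Lowering a minimal \<open>f\<close> along the ray through \<open>z\<close> changes nothing, so
  \<open>f x \<le> f (x + z) - f z\<close>: the functional is superadditive as well as subadditive.
\<close>

lemma minimal_sublinear_imp_linear:
  fixes f :: "'v::real_vector \<Rightarrow> real"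
  assumes f: "sublinear f"
    and minimal: "\<And>g. sublinear g \<Longrightarrow> (\<And>x. g x \<le> f x) \<Longrightarrow> g = f"
  shows "linear f"
proof -
  have add: "f (x + z) = f x + f z" for x z
  proof -
    obtain g where "sublinear g" "\<And>x. g x \<le> f x" "\<And>x. g x \<le> f (x + z) - f z"
      using sublinear_lowered_along_ray[OF f, of z] by blast
    with minimal[of g] have "f x \<le> f (x + z) - f z"
      by metis
    with sublinear_add[OF f, of x z] show ?thesis
      by simp
  qed
  have neg: "f (- x) = - f x" for x
    using add[of x "- x"] sublinear_zero[OF f] by simp
  have "f (r *\<^sub>R x) = r *\<^sub>R f x" for r x
  proof (cases "0 \<le> r")
    case True
    then show ?thesis
      by (simp add: sublinear_scaleR[OF f])
  next
    case False
    then show ?thesis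
      using sublinear_scaleR[OF f, of "- r" x] neg[of "r *\<^sub>R x"] by simp
  qed
  with add show ?thesis
    by (intro linearI) auto
qed

lemma minimal_sublinear_exists:
  fixes p :: "'v::real_vector \<Rightarrow> real"
  assumes p: "sublinear p"
  obtains f where "sublinear f" "\<And>x. f x \<le> p x"
    "\<And>g. sublinear g \<Longrightarrow> (\<And>x. g x \<le> f x) \<Longrightarrow> g = f"
proof -
  let ?A = "{f. sublinear f \<and> f \<le> p}"
  let ?P = "\<lambda>f g. g \<le> f"
  have "\<exists>m\<in>?A. \<forall>g\<in>?A. ?P m g \<longrightarrow> g = m"
  proof (rule predicate_Zorn)
    show "partial_order_on ?A (relation_of ?P ?A)"
      by (rule partial_order_on_relation_ofI) auto
  next
    fix C
    assume "C \<in> Chains (relation_of ?P ?A)"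
    then have C: "C \<subseteq> ?A" and chain: "\<And>f g. f \<in> C \<Longrightarrow> g \<in> C \<Longrightarrow> f \<le> g \<or> g \<le> f"
      unfolding Chains_def relation_of_def by auto
    show "\<exists>u\<in>?A. \<forall>f\<in>C. u \<le> f"
    proof (cases "C = {}")
      case True
      with p show ?thesis
        by auto
    next
      case ne: False
      let ?u = "\<lambda>x. INF f\<in>C. f x"
      have "- p (- x) \<le> f x" if "f \<in> C" for f x
      proof -
        from that C have f: "sublinear f" "f (- x) \<le> p (- x)"
          by (auto simp: le_fun_def)
        show ?thesis
          using sublinear_add[OF f(1), of x "- x"] sublinear_zero[OF f(1)] f(2) by simp
      qed
      then have bdd: "bdd_below ((\<lambda>f. f x) ` C)" for x
        by (intro bdd_belowI2[where m = "- p (- x)"])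
      have lower: "?u x \<le> f x" if "f \<in> C" for f x
        using cINF_lower[OF bdd that] .
      have "sublinear ?u"
      proof (rule sublinear_INF[OF ne bdd])
        fix f g :: "'v \<Rightarrow> real" and x y :: 'v
        assume fg: "f \<in> C" "g \<in> C"
        \<comment> \<open>the smaller of the two functionals serves\<close>
        from chain[OF fg] fg obtain m where m: "m \<in> C" "m \<le> f" "m \<le> g"
          by auto
        with C have "m (x + y) \<le> m x + m y"
          by (auto intro: sublinear_add)
        also have "\<dots> \<le> f x + g y"
          using m by (intro add_mono) (auto simp: le_fun_def)
        finally show "\<exists>k\<in>C. k (x + y) \<le> f x + g y"
          using m(1) by blast
      next
        fix f :: "'v \<Rightarrow> real" and r :: real and x :: 'v
        assume "f \<in> C" "0 \<le> r"
        with C show "\<exists>k\<in>C. k (r *\<^sub>R x) \<le> r * f x"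
          by (intro bexI[of _ f]) (auto simp: sublinear_scaleR)
      qed
      moreover from ne obtain f where "f \<in> C"
        by auto
      with C have "f \<le> p"
        by auto
      with lower[OF \<open>f \<in> C\<close>] have "?u \<le> p"
        unfolding le_fun_def using order.trans by blast
      ultimately show ?thesis
        using lower by (intro bexI[of _ ?u]) (auto simp: le_fun_def)
    qed
  qed
  then obtain f where f: "f \<in> ?A" and min: "\<forall>g\<in>?A. g \<le> f \<longrightarrow> g = f"
    by blast
  show ?thesis
  proof (rule that)
    show "sublinear f" "f x \<le> p x" for x
      using f by (auto simp: le_fun_def)
    show "g = f" if g: "sublinear g" "\<And>x. g x \<le> f x" for g
    proof -
      have "g \<le> f"
        using g(2) by (simp add: le_fun_def)
      moreover from this f have "g \<le> p"
        by auto
      ultimately show ?thesis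
        using min g(1) by blast
    qed
  qed
qed

text \<open>
  Attainment at \<open>y\<close> comes from lowering \<open>p\<close> along the ray through \<open>y\<close> before minimising: the
  resulting \<open>f\<close> has \<open>f (- y) \<le> - p y\<close>, that is \<open>f y \<ge> p y\<close>.
\<close>

lemma supporting_linear_functional:
  fixes p :: "'v::real_vector \<Rightarrow> real"
  assumes p: "sublinear p"
  obtains f where "linear f" "\<And>x. f x \<le> p x" "f y = p y"
proof -
  obtain g where g: "sublinear g" "\<And>x. g x \<le> p x" "\<And>x. g x \<le> p (x + y) - p y"
    using sublinear_lowered_along_ray[OF p, of y] by blast
  obtain f where f: "sublinear f" "\<And>x. f x \<le> g x"
    and min: "\<And>h. sublinear h \<Longrightarrow> (\<And>x. h x \<le> f x) \<Longrightarrow> h = f"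
    using minimal_sublinear_exists[OF g(1)] by metis
  have lin: "linear f"
    by (rule minimal_sublinear_imp_linear[OF f(1) min])
  have le: "f x \<le> p x" for x
    using f(2) g(2) order.trans by blast
  have "f (- y) \<le> p (- y + y) - p y"
    using f(2) g(3) order.trans by blast
  then have "p y \<le> f y"
    using sublinear_zero[OF p] linear_neg[OF lin, of y] by simp
  with le[of y] have "f y = p y"
    by simp
  with lin le that show ?thesis
    by blast
qed

section \<open>Norming functionals over the scalar field\<close>

text \<open>
  The two disjuncts on \<open>i\<close> are the real and the complex case; complexification of a real
  functional can then be carried out for both at once. The last clause makes the real part a contraction.
  In particular, a scalar equal to a real number has that number as its real part.
\<close>

lemma imaginary_unit_or_zero:
  obtains i :: "'k::real_or_complex"
  where "i = 0 \<or> i * i = - 1" "\<And>k. \<exists>a b. k = of_real a + of_real b * i"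
    "\<And>a b. \<bar>a\<bar> \<le> norm (of_real a + of_real b * i)"
proof -
  consider (real) h :: "'k \<Rightarrow> real" where "bij h" "\<And>r x. h (r *\<^sub>R x) = r *\<^sub>R h x"
      "\<And>x y. h (x * y) = h x * h y"
    | (complex) h :: "'k \<Rightarrow> complex" where "bij h" "\<And>x y. h (x + y) = h x + h y"
      "\<And>r x. h (r *\<^sub>R x) = r *\<^sub>R h x" "\<And>x y. h (x * y) = h x * h y"
      "\<And>x. norm (h x) = norm x"
    using iso_real_or_complex[where 'a = 'k] by blast
  then show ?thesis
  proof cases
    case real
    have inj: "x = y" if "h x = h y" for x y
      using real(1) that by (auto dest: bij_is_inj injD)
    have "h 0 = 0"
      using real(2)[of 0 0] by simp
    then have "h 1 \<noteq> 0"
      using inj[of 1 0] by auto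
    then have "h 1 = 1"
      using real(3)[of 1 1] by simp
    then have "k = of_real (h k)" for k
      using real(2)[of "h k" 1] by (intro inj) (simp add: of_real_def)
    then have "\<exists>a b. k = of_real a + of_real b * 0" for k :: 'k
      by (intro exI[of _ "h k"]) simp
    then show ?thesis
      using that[of 0] by simp
  next
    case complex
    have inj: "x = y" if "h x = h y" for x y
      using complex(1) that by (auto dest: bij_is_inj injD)
    have "h 0 = 0"
      using complex(3)[of 0 0] by simp
    then have "h 1 \<noteq> 0"
      using inj[of 1 0] by auto
    then have h1: "h 1 = 1"
      using complex(4)[of 1 1] by simp
    have hr: "h (of_real r) = of_real r" for r
      using complex(3)[of r 1] h1 by (simp add: of_real_def)
    obtain i where i: "h i = \<i>"
      using complex(1) by (metis bij_pointE)
    have "i * i = - 1"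
      using hr[of "- 1"] by (intro inj) (simp add: complex(4) i)
    moreover have "k = of_real (Re (h k)) + of_real (Im (h k)) * i" for k
      by (intro inj) (simp add: complex(2,4) hr i complex_eq_iff)
    moreover have "\<bar>a\<bar> \<le> norm (of_real a + of_real b * i)" for a b
    proof -
      have "h (of_real a + of_real b * i) = Complex a b"
        by (simp add: complex(2,4) hr i complex_eq_iff)
      with abs_Re_le_cmod[of "Complex a b"] complex(5) show ?thesis
        by (metis complex.sel(1))
    qed
    ultimately show ?thesis
      using that by blast
  qed
qed

lemma linear_over_scalars_imp_linear:
  assumes "scalar_vector_space s1" "scalar_vector_space s2" "Vector_Spaces.linear s1 s2 f"
  shows "linear f"
proof -
  interpret s1: scalar_vector_space s1 by fact
  interpret s2: scalar_vector_space s2 by fact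
  interpret f: Vector_Spaces.linear s1 s2 f by fact
  show ?thesis
    using f.scale[of "of_real _"]
    by (intro linearI) (simp_all add: f.add s1.scale_of_real s2.scale_of_real)
qed

lemma scalar_vector_space_scalars: "scalar_vector_space ((*) :: 'k::real_or_complex \<Rightarrow> 'k \<Rightarrow> 'k)"
  by unfold_locales (simp_all add: algebra_simps scaleR_conv_of_real)

text \<open>
  Once \<open>\<phi>\<close> is linear over the scalars, its bound follows from that of \<open>f\<close> by rotating \<open>x\<close> so
  that \<open>\<phi> x\<close> becomes a nonnegative real, where \<open>\<phi>\<close> and \<open>f\<close> agree.
\<close>

lemma norming_functional:
  fixes sL :: "'k::real_or_complex \<Rightarrow> 'l::real_normed_vector \<Rightarrow> 'l"
  assumes "scalar_normed_space sL"
  obtains \<phi> where "Vector_Spaces.linear sL (*) \<phi>" "\<And>x. norm (\<phi> x) \<le> norm x" "norm (\<phi> y) = norm y"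
proof -
  interpret scalar_normed_space sL by fact
  obtain i :: 'k where i: "i = 0 \<or> i * i = - 1" and decomp: "\<And>k. \<exists>a b. k = of_real a + of_real b * i"
    and real_part: "\<And>a b. \<bar>a\<bar> \<le> norm (of_real a + of_real b * i)"
    using imaginary_unit_or_zero by blast
  obtain f where lin: "linear f" and le: "\<And>x. f x \<le> norm x" and fy: "f y = norm y"
    using supporting_linear_functional[OF sublinear_norm] by blast
  define \<phi> where "\<phi> x = of_real (f x) - i * of_real (f (sL i x))" for x
  have add: "\<phi> (x + z) = \<phi> x + \<phi> z" for x z
    by (simp add: \<phi>_def linear_add[OF lin] scale_right_distrib algebra_simps)
  have real: "\<phi> (sL (of_real r) x) = of_real r * \<phi> x" for r x
  proof -
    have "sL i (r *\<^sub>R x) = r *\<^sub>R sL i x"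
      by (metis scale_left_commute scale_of_real)
    then show ?thesis
      by (simp add: \<phi>_def scale_of_real linear_scale[OF lin] algebra_simps)
  qed
  have imag: "\<phi> (sL i x) = i * \<phi> x" for x
    using i
  proof
    assume "i = 0"
    then show ?thesis
      by (simp add: \<phi>_def linear_0[OF lin])
  next
    assume ii: "i * i = - 1"
    then have "sL i (sL i x) = - x"
      by (simp add: scale_minus_left)
    moreover have "i * (i * c) = - c" for c
      by (metis ii mult.assoc mult_minus1)
    ultimately show ?thesis
      by (simp only: \<phi>_def linear_neg[OF lin] right_diff_distrib of_real_minus) simp
  qed
  have scale: "\<phi> (sL k x) = k * \<phi> x" for k x
  proof -
    obtain a b where k: "k = of_real a + of_real b * i"
      using decomp by blast
    have "sL k x = sL (of_real a) x + sL (of_real b) (sL i x)"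
      by (simp only: k scale_left_distrib scale_scale)
    then show ?thesis
      by (simp only: add real imag k distrib_right mult.assoc)
  qed
  have real_value: "\<bar>f x - r\<bar> \<le> norm (\<phi> x - of_real r)" for r x
    \<comment> \<open>\<open>f\<close> is the real part of \<open>\<phi>\<close>, so \<open>f x - r\<close> is the real part of \<open>\<phi> x - r\<close>\<close>
    using real_part[of "f x - r" "- f (sL i x)"] by (simp add: \<phi>_def algebra_simps)
  have bound: "norm (\<phi> x) \<le> norm x" for x
  proof (cases "\<phi> x = 0")
    case False
    define c where "c = of_real (norm (\<phi> x)) / \<phi> x"
    have "\<phi> (sL c x) = of_real (norm (\<phi> x))"
      using False by (simp add: scale c_def)
    then have "norm (\<phi> x) = f (sL c x)"
      using real_value[of "sL c x" "norm (\<phi> x)"] by simp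
    also have "\<dots> \<le> norm (sL c x)"
      by (rule le)
    also have "\<dots> = norm x"
      using False by (simp add: norm_scale c_def norm_divide)
    finally show ?thesis .
  qed simp
  have "norm y \<le> norm (\<phi> y)"
    using real_value[of y 0] fy by simp
  moreover have "Vector_Spaces.linear sL (*) \<phi>"
    using vector_space_axioms scalar_vector_space_scalars[where 'k = 'k] add scale
    by (simp add: Vector_Spaces.linear_iff scalar_vector_space_def)
  ultimately show ?thesis
    using that bound order.antisym by blast
qed


section \<open>The dual unit ball and the adjoint\<close>

text \<open>
  Continuity gives boundedness here, which is what makes \<open>onorm\<close> the actual norm of the dual
  (its defining supremum is over a bounded set).
\<close>

lemma bounded_linear_if_in_dual:
  fixes sL :: "'k::real_or_complex \<Rightarrow> 'l::real_normed_vector \<Rightarrow> 'l"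
  assumes "scalar_vector_space sL" "\<phi> \<in> topological_dual sL"
  shows "bounded_linear \<phi>"
proof -
  have lin: "linear \<phi>" and cont: "continuous_on UNIV \<phi>"
    using assms(2) linear_over_scalars_imp_linear[OF assms(1) scalar_vector_space_scalars]
    by (auto simp: topological_dual_def continuous_operator_def)
  from cont have "isCont \<phi> 0"
    by (simp add: continuous_on_eq_continuous_at)
  then obtain d where d: "0 < d" "\<And>x. norm x < d \<Longrightarrow> norm (\<phi> x) < 1"
    by (auto simp: continuous_at_eps_delta dist_norm linear_0[OF lin] dest: spec[of _ 1])
  have "norm (\<phi> x) \<le> norm x * (2 / d)" for x
  proof (cases "x = 0")
    case False
    have "norm (\<phi> ((d / (2 * norm x)) *\<^sub>R x)) < 1"
      using d(1) False by (intro d(2)) simp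
    then show ?thesis
      using d(1) False by (simp add: linear_scale[OF lin] field_simps)
  qed (simp add: linear_0[OF lin])
  then show ?thesis
    using lin by (intro bounded_linear_intro[where K = "2 / d"]) (auto simp: linear_add linear_scale)
qed

lemma dual_unit_ball_iff:
  fixes sL :: "'k::real_or_complex \<Rightarrow> 'l::real_normed_vector \<Rightarrow> 'l"
  assumes "scalar_vector_space sL"
  shows "\<phi> \<in> dual_unit_ball sL \<longleftrightarrow>
    Vector_Spaces.linear sL (*) \<phi> \<and> (\<forall>x. norm (\<phi> x) \<le> norm x)"
proof (intro iffI conjI allI)
  assume \<phi>: "\<phi> \<in> dual_unit_ball sL"
  then show "Vector_Spaces.linear sL (*) \<phi>"
    by (simp add: dual_unit_ball_def topological_dual_def continuous_operator_def)
  have "bounded_linear \<phi>"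
    using \<phi> by (intro bounded_linear_if_in_dual[OF assms]) (simp add: dual_unit_ball_def)
  then have "norm (\<phi> x) \<le> onorm \<phi> * norm x" for x
    by (rule onorm)
  also have "onorm \<phi> * norm x \<le> norm x" for x
    using \<phi> by (simp add: dual_unit_ball_def mult_left_le_one_le onorm_pos_le \<open>bounded_linear \<phi>\<close>)
  finally show "norm (\<phi> x) \<le> norm x" for x .
next
  assume *: "Vector_Spaces.linear sL (*) \<phi> \<and> (\<forall>x. norm (\<phi> x) \<le> norm x)"
  then have "linear \<phi>"
    using linear_over_scalars_imp_linear[OF assms scalar_vector_space_scalars] by blast
  with * have "bounded_linear \<phi>"
    by (intro bounded_linear_intro[where K = 1]) (auto simp: linear_add linear_scale)
  then have "continuous_on UNIV \<phi>"
    by (simp add: linear_continuous_on)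
  moreover have "onorm \<phi> \<le> 1"
    using * by (intro onorm_bound) auto
  ultimately show "\<phi> \<in> dual_unit_ball sL"
    using * by (simp add: dual_unit_ball_def topological_dual_def continuous_operator_def)
qed

lemma dual_unit_ball_nonempty:
  fixes sL :: "'k::real_or_complex \<Rightarrow> 'l::real_normed_vector \<Rightarrow> 'l"
  assumes "scalar_normed_space sL"
  shows "dual_unit_ball sL \<noteq> {}"
proof -
  obtain \<phi> where "Vector_Spaces.linear sL (*) \<phi>" "\<And>x. norm (\<phi> x) \<le> norm x"
    using norming_functional[OF assms] by metis
  then show ?thesis
    using dual_unit_ball_iff[of sL] assms by (auto simp: scalar_normed_space_def)
qed

lemma SUP_dual_unit_ball:
  fixes sL :: "'k::real_or_complex \<Rightarrow> 'l::real_normed_vector \<Rightarrow> 'l"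
  assumes L: "scalar_normed_space sL"
  shows "(SUP \<phi>\<in>dual_unit_ball sL. norm (\<phi> y)) = norm y"
proof (rule cSup_eq_maximum)
  have ball: "\<phi> \<in> dual_unit_ball sL \<longleftrightarrow>
      Vector_Spaces.linear sL (*) \<phi> \<and> (\<forall>x. norm (\<phi> x) \<le> norm x)" for \<phi>
    using L by (intro dual_unit_ball_iff) (simp add: scalar_normed_space_def)
  obtain \<phi> where "Vector_Spaces.linear sL (*) \<phi>" "\<And>x. norm (\<phi> x) \<le> norm x" "norm (\<phi> y) = norm y"
    using norming_functional[OF L] by metis
  then show "norm y \<in> (\<lambda>\<phi>. norm (\<phi> y)) ` dual_unit_ball sL"
    by (intro image_eqI[of _ _ \<phi>]) (simp_all add: ball)
  show "z \<le> norm y" if "z \<in> (\<lambda>\<phi>. norm (\<phi> y)) ` dual_unit_ball sL" for z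
    using that by (auto simp: ball)
qed

lemma dual_map_in_dual:
  assumes T: "continuous_operator sE sL T" and \<phi>: "\<phi> \<in> topological_dual sL"
  shows "dual_map T \<phi> \<in> topological_dual sE"
proof -
  have "Vector_Spaces.linear sE (*) (\<phi> \<circ> T)"
    using T \<phi> by (auto simp: topological_dual_def continuous_operator_def
        intro: Vector_Spaces.linear_compose)
  moreover have "continuous_on UNIV (\<phi> \<circ> T)"
    using T \<phi> by (auto simp: topological_dual_def continuous_operator_def
        intro!: continuous_on_compose intro: continuous_on_subset simp del: o_apply)
  ultimately show ?thesis
    by (simp add: topological_dual_def continuous_operator_def dual_map_def comp_def)
qed

text \<open>
  For \<open>\<phi>\<close> in the unit ball, \<open>\<bar>\<phi> (T x)\<bar> \<le> \<parallel>T x\<parallel>\<close>, so the open set \<open>{x. \<parallel>T x\<parallel> < 1}\<close> is a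
  neighbourhood of zero whose polar contains every \<open>T\<^sup>* \<phi>\<close>.
\<close>

lemma equicontinuous_dual_map_unit_ball:
  fixes sE :: "'k::real_or_complex \<Rightarrow> 'e::{real_vector,topological_space} \<Rightarrow> 'e"
    and sL :: "'k \<Rightarrow> 'l::real_normed_vector \<Rightarrow> 'l"
  assumes L: "scalar_vector_space sL" and T: "continuous_operator sE sL T"
  shows "equicontinuous_set sE (dual_map T ` dual_unit_ball sL)"
proof -
  let ?U = "{x. norm (T x) < 1}"
  have lin: "Vector_Spaces.linear sE sL T" and "continuous_on UNIV T"
    using T by (simp_all add: continuous_operator_def)
  then have "open ?U"
    by (intro open_Collect_less continuous_on_norm continuous_on_const)
  moreover from lin interpret T: Vector_Spaces.linear sE sL T .
  have "T 0 = 0"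
    by (rule T.zero)
  ultimately have "0 \<in> interior ?U"
    by (simp add: interior_open)
  moreover have "dual_map T \<phi> \<in> polar sE ?U" if "\<phi> \<in> dual_unit_ball sL" for \<phi>
  proof -
    from that have "norm (\<phi> (T x)) \<le> norm (T x)" for x
      by (simp add: dual_unit_ball_iff[OF L])
    then have "norm (\<phi> (T x)) \<le> 1" if "x \<in> ?U" for x
      using that by (meson mem_Collect_eq less_imp_le order.trans)
    moreover from that have "dual_map T \<phi> \<in> topological_dual sE"
      by (intro dual_map_in_dual[OF T]) (simp add: dual_unit_ball_def)
    ultimately show ?thesis
      by (simp add: polar_def dual_map_def)
  qed
  ultimately show ?thesis
    unfolding equicontinuous_set_def by blast
qed

section \<open>The characterisation\<close>

theorem theorem16p3:
  fixes sE :: "'k::real_or_complex \<Rightarrow> 'e::{real_vector,topological_ab_group_add,t2_space} \<Rightarrow> 'e"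
    and sL :: "'k \<Rightarrow> 'l::real_normed_vector \<Rightarrow> 'l"
    and T :: "'e \<Rightarrow> 'l"
    and p q :: ereal
  assumes "1 \<le> p" and "p \<le> q"
    and "locally_convex_space sE"
    and "scalar_normed_space sL"
    and "continuous_operator sE sL T"
  shows "convergent_map sE sL q p T \<longleftrightarrow> EV_set sE p q (dual_map T ` dual_unit_ball sL)"
proof -
  let ?B = "dual_map T ` dual_unit_ball sL"
  note L = assms(4) and T = assms(5)
  have "(SUP \<psi>\<in>?B. norm (\<psi> x)) = norm (T x)" for x
    using SUP_dual_unit_ball[OF L, of "T x"] by (simp add: image_image dual_map_def)
  then have "EV_set sE p q ?B \<longleftrightarrow> ?B \<noteq> {} \<and> ?B \<subseteq> topological_dual sE \<and> equicontinuous_set sE ?B \<and>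
      (\<forall>x. weakly_summable sE p x \<longrightarrow> strongly_summable q (\<lambda>n. T (x n)))"
    by (simp add: EV_set_def strongly_summable_def)
  moreover have "?B \<noteq> {}"
    using dual_unit_ball_nonempty[OF L] by simp
  moreover have "?B \<subseteq> topological_dual sE"
    using dual_map_in_dual[OF T] by (auto simp: dual_unit_ball_def)
  moreover have "equicontinuous_set sE ?B"
    using L T by (intro equicontinuous_dual_map_unit_ball) (simp_all add: scalar_normed_space_def)
  moreover have "Vector_Spaces.linear sE sL T"
    using T by (simp add: continuous_operator_def)
  ultimately show ?thesis
    by (simp add: convergent_map_def)
qed

end
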